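(* Let $a\in\mathbb{R}$, $b\in\mathbb{N}_{a+2}$, $0<\nu<1$, $p:\mathbb{N}_{a+1}\to(0,\infty)$, $q:\mathbb{N}_{a+1}\to\mathbb{R}$, and $(L_ax)(t)=\nabla[p(t+1)\nabla_{a*}^{\nu}x(t+1)]+q(t)x(t)$. Let $\alpha,\beta,\gamma,\delta\in\mathbb{R}$ with $\alpha^2+\beta^2>0$ and $\gamma^2+\delta^2>0$, and let $h:\mathbb{N}_{a+1}^{b-1}\to\mathbb{R}$. Assume that the homogeneous boundary value problem $$L_ax(t)=0\ \ (t\in\mathbb{N}_{a+1}^{b-1}),\qquad \alpha x(a)-\beta\nabla x(a+1)=0,\qquad \gamma x(b)+\delta\nabla x(b)=0,$$ for $x:\mathbb{N}_a^b\to\mathbb{R}$, has only the trivial solution $x\equiv0$, and let $G(t,s)$ be the Green's function for this homogeneous boundary value problem. Then the solution $y:\mathbb{N}_a^b\to\mathbb{R}$ of the boundary value problem $$L_ay(t)=h(t)\ \ (t\in\mathbb{N}_{a+1}^{b-1}),\qquad \alpha y(a)-\beta\nabla y(a+1)=0,\qquad \gamma y(b)+\delta\nabla y(b)=0,$$ is given by $$y(t)=\int_a^bG(t,s)h(s)\,\nabla s,\qquad t\in\mathbb{N}_a^b.$$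
   Context: For $a\in\mathbb{R}$, $\mathbb{N}_a=\{a,a+1,a+2,\dots\}$, and for $b\in\mathbb{N}_a$, $\mathbb{N}_a^b=\{a,a+1,\dots,b\}$. The nabla difference is $\nabla f(t)=f(t)-f(t-1)$ (for functions of $(t,s)$ it acts in $t$). The definite nabla integral is $\int_c^d f(s)\nabla s=\sum_{s=c+1}^d f(s)$ if $c<d$, and $0$ if $d\le c$. The generalized rising function is $t^{\overline{\mu}}=\Gamma(t+\mu)/\Gamma(t)$, with the convention $t^{\overline{\mu}}=0$ if $t$ is a non-positive integer and $t+\mu$ is not a non-positive integer. For $0<\nu<1$ the Caputo nabla fractional difference based at $a$ is $\nabla_{a*}^{\nu}x(t)=\sum_{\tau=a+1}^{t}\frac{(t-\tau+1)^{\overline{-\nu}}}{\Gamma(1-\nu)}\nabla x(\tau)$ (empty sums are $0$); $\nabla_{a*}^{\nu}x(t+1)$ denotes its value at $t+1$. In $L_a$ the outer $\nabla$ acts in $t$, so $\nabla[p(t+1)\nabla_{a*}^{\nu}x(t+1)]=p(t+1)\nabla_{a*}^{\nu}x(t+1)-p(t)\nabla_{a*}^{\nu}x(t)$. For $s\in\mathbb{N}_a$, $L_s$ denotes the same operator with base point $a$ replaced by $s$: $(L_sx)(t)=\nabla[p(t+1)\nabla_{s*}^{\nu}x(t+1)]+q(t)x(t)$, $t\in\mathbb{N}_{s+1}$, for $x:\mathbb{N}_s\to\mathbb{R}$. Cauchy function: $x(t,s)$ ($s\in\mathbb{N}_a$, $t\in\mathbb{N}_s$) is the function such that, for each fixed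 $s\in\mathbb{N}_a$, $x(\cdot,s)$ solves $L_sx(t,s)=0$ for $t\in\mathbb{N}_{s+1}$, $x(s,s)=0$, $\nabla x(s+1,s)=\frac1{p(s+1)}$. By convention $x(s-1,s)=0$, so that $\nabla x(s,s)=0$. Green's function: when the homogeneous boundary value problem has only the trivial solution, its Green's function is $$G(t,s)=\begin{cases}u(t,s),& a\le t\le s\le b,\\ v(t,s),& a\le s\le t\le b,\end{cases}$$ for $t,s\in\mathbb{N}_a^b$, where for each fixed $s\in\mathbb{N}_a^b$, $u(\cdot,s):\mathbb{N}_a^b\to\mathbb{R}$ solves the boundary value problem $L_au(t,s)=0$ for $t\in\mathbb{N}_{a+1}^{b-1}$, $\alpha u(a,s)-\beta\nabla u(a+1,s)=0$, $\gamma u(b,s)+\delta\nabla u(b,s)=-[\gamma x(b,s)+\delta\nabla x(b,s)]$, with $x(t,s)$ the Cauchy function for $L_a$, and $v(t,s)=u(t,s)+x(t,s)$. (The two cases agree at $t=s$ because $x(s,s)=0$.) Since $h$ is only given on $\mathbb{N}_{a+1}^{b-1}$, the value $h(b)$ appearing in $\int_a^bG(t,s)h(s)\nabla s$ may be assigned arbitrarily. *)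

theory Defs
  imports "HOL-Analysis.Analysis"
begin

definition N_from :: "real \<Rightarrow> real set" where
  "N_from a = {a + real n | n. True}"

definition N_between :: "real \<Rightarrow> real \<Rightarrow> real set" where
  "N_between a b = {t \<in> N_from a. t \<le> b}"

definition nabla :: "(real \<Rightarrow> real) \<Rightarrow> real \<Rightarrow> real" where
  "nabla f t = f t - f (t - 1)"

definition nabla_integral :: "real \<Rightarrow> real \<Rightarrow> (real \<Rightarrow> real) \<Rightarrow> real" where
  "nabla_integral c d f = (if c < d then \<Sum>s\<in>N_between (c + 1) d. f s else 0)"

definition rising :: "real \<Rightarrow> real \<Rightarrow> real" where
  "rising t \<mu> = (if t \<in> \<int>\<^sub>\<le>\<^sub>0 \<and> t + \<mu> \<notin> \<int>\<^sub>\<le>\<^sub>0 then 0 else Gamma (t + \<mu>) / Gamma t)"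

text \<open>
  A function with domain \<open>N_from a\<close> or \<open>N_between a b\<close> is rendered as a total function on the
  reals.  All expressions below only inspect it on its domain, with one exception covered by an
  explicit convention (see the Cauchy function).
\<close>

definition caputo :: "real \<Rightarrow> real \<Rightarrow> (real \<Rightarrow> real) \<Rightarrow> real \<Rightarrow> real" where
  "caputo \<nu> a x t =
     (\<Sum>\<tau>\<in>N_between (a + 1) t. rising (t - \<tau> + 1) (- \<nu>) / Gamma (1 - \<nu>) * nabla x \<tau>)"

definition L_op :: "real \<Rightarrow> (real \<Rightarrow> real) \<Rightarrow> (real \<Rightarrow> real) \<Rightarrow> real \<Rightarrow> (real \<Rightarrow> real) \<Rightarrow> real \<Rightarrow> real" where
  "L_op \<nu> p q a x t = nabla (\<lambda>r. p (r + 1) * caputo \<nu> a x (r + 1)) t + q t * x t"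

text \<open>
  The definite description is meaningful because the initial value problem is uniquely solvable
  on \<open>N_from s\<close> when \<open>p\<close> is positive.  Requiring the value 0 off \<open>N_from s\<close> makes the total
  function unique, and contains the convention \<open>x(s - 1, s) = 0\<close>.
\<close>

definition cauchy_fun :: "real \<Rightarrow> (real \<Rightarrow> real) \<Rightarrow> (real \<Rightarrow> real) \<Rightarrow> real \<Rightarrow> real \<Rightarrow> real" where
  "cauchy_fun \<nu> p q t s =
     (THE x. (\<forall>r. r \<notin> N_from s \<longrightarrow> x r = 0) \<and>
             (\<forall>r\<in>N_from (s + 1). L_op \<nu> p q s x r = 0) \<and>
             x s = 0 \<and> nabla x (s + 1) = 1 / p (s + 1)) t"

definition solves_bvp ::
  "real \<Rightarrow> (real \<Rightarrow> real) \<Rightarrow> (real \<Rightarrow> real) \<Rightarrow> real \<Rightarrow> real \<Rightarrow> real \<Rightarrow> real \<Rightarrow> real \<Rightarrow> real \<Rightarrow>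
   (real \<Rightarrow> real) \<Rightarrow> real \<Rightarrow> (real \<Rightarrow> real) \<Rightarrow> bool" where
  "solves_bvp \<nu> p q a b \<alpha> \<beta> \<gamma> \<delta> h c x \<longleftrightarrow>
     (\<forall>t\<in>N_between (a + 1) (b - 1). L_op \<nu> p q a x t = h t) \<and>
     \<alpha> * x a - \<beta> * nabla x (a + 1) = 0 \<and>
     \<gamma> * x b + \<delta> * nabla x b = c"

text \<open>
  For \<open>s\<close> in \<open>N_between a b\<close> the function \<open>u(\<cdot>, s)\<close> exists and is unique once the homogeneous
  problem has only the trivial solution; again the value 0 is imposed off the domain.
\<close>

definition green_u ::
  "real \<Rightarrow> (real \<Rightarrow> real) \<Rightarrow> (real \<Rightarrow> real) \<Rightarrow> real \<Rightarrow> real \<Rightarrow> real \<Rightarrow> real \<Rightarrow> real \<Rightarrow> real \<Rightarrow>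
   real \<Rightarrow> real \<Rightarrow> real" where
  "green_u \<nu> p q a b \<alpha> \<beta> \<gamma> \<delta> t s =
     (THE u. (\<forall>r. r \<notin> N_between a b \<longrightarrow> u r = 0) \<and>
             solves_bvp \<nu> p q a b \<alpha> \<beta> \<gamma> \<delta> (\<lambda>r. 0)
               (- (\<gamma> * cauchy_fun \<nu> p q b s + \<delta> * nabla (\<lambda>r. cauchy_fun \<nu> p q r s) b)) u) t"

definition green_v ::
  "real \<Rightarrow> (real \<Rightarrow> real) \<Rightarrow> (real \<Rightarrow> real) \<Rightarrow> real \<Rightarrow> real \<Rightarrow> real \<Rightarrow> real \<Rightarrow> real \<Rightarrow> real \<Rightarrow>
   real \<Rightarrow> real \<Rightarrow> real" where
  "green_v \<nu> p q a b \<alpha> \<beta> \<gamma> \<delta> t s =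
     green_u \<nu> p q a b \<alpha> \<beta> \<gamma> \<delta> t s + cauchy_fun \<nu> p q t s"

definition green_fun ::
  "real \<Rightarrow> (real \<Rightarrow> real) \<Rightarrow> (real \<Rightarrow> real) \<Rightarrow> real \<Rightarrow> real \<Rightarrow> real \<Rightarrow> real \<Rightarrow> real \<Rightarrow> real \<Rightarrow>
   real \<Rightarrow> real \<Rightarrow> real" where
  "green_fun \<nu> p q a b \<alpha> \<beta> \<gamma> \<delta> t s =
     (if t \<le> s then green_u \<nu> p q a b \<alpha> \<beta> \<gamma> \<delta> t s else green_v \<nu> p q a b \<alpha> \<beta> \<gamma> \<delta> t s)"

end

theory Submission
  imports Defs
begin

text \<open>
  Extended by zero below \<open>s\<close>, the Cauchy function \<open>x(\<cdot>, s)\<close> satisfies \<open>L\<^sub>a x(\<cdot>, s) = 1\<close> at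
  \<open>s\<close> and \<open>L\<^sub>a x(\<cdot>, s) = 0\<close> at all other points, because a Caputo difference does not notice a
  change of the base point across a stretch where the function is constant.  Hence superposition of
  \<open>u(\<cdot>, s) + x(\<cdot>, s)\<close>, which agrees with \<open>G(\<cdot>, s)\<close>, with weights \<open>h(s)\<close> solves the boundary value
  problem.  The functions \<open>u(\<cdot>, s)\<close> exist since the initial value problem
  \<open>L\<^sub>a \<phi> = 0\<close>, \<open>\<phi>(a) = \<beta>\<close>, \<open>\<nabla>\<phi>(a + 1) = \<alpha>\<close> has a nonzero solution; it satisfies the left
  boundary condition, so it violates the right one, and a multiple of it attains any right
  boundary value.
\<close>

section \<open>Grids\<close>

lemma N_from_iff: "t \<in> N_from a \<longleftrightarrow> (\<exists>n. t = a + real n)"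
  by (auto simp: N_from_def)

lemma N_from_add_nat [simp]: "a + real n \<in> N_from a"
  by (auto simp: N_from_def)

lemma N_from_self [simp]: "a \<in> N_from a"
  using N_from_add_nat[of a 0] by simp

lemma N_from_ge: "t \<in> N_from a \<Longrightarrow> a \<le> t"
  by (auto simp: N_from_def)

lemma N_from_trans: "t \<in> N_from s \<Longrightarrow> s \<in> N_from a \<Longrightarrow> t \<in> N_from a"
  unfolding N_from_iff by (metis add.assoc of_nat_add)

lemma N_from_succ_iff: "t \<in> N_from (s + 1) \<longleftrightarrow> t - 1 \<in> N_from s"
  unfolding N_from_iff by (auto simp: algebra_simps)

lemma N_from_cases: "t \<in> N_from s \<longleftrightarrow> t = s \<or> t \<in> N_from (s + 1)"
proof
  assume "t \<in> N_from s"
  then obtain n where n: "t = s + real n" by (auto simp: N_from_iff)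
  then show "t = s \<or> t \<in> N_from (s + 1)"
    by (cases n) (auto simp: N_from_iff)
next
  assume "t = s \<or> t \<in> N_from (s + 1)"
  then show "t \<in> N_from s"
    using N_from_add_nat[of s 1] N_from_trans[of t "s + 1" s] by auto
qed

lemma N_from_comparable:
  assumes "t \<in> N_from a" "s \<in> N_from a" "s \<le> t"
  shows "t \<in> N_from s"
proof -
  obtain m n where "t = a + real m" "s = a + real n"
    using assms by (auto simp: N_from_iff)
  moreover from this have "n \<le> m" using assms(3) by simp
  ultimately have "t = s + real (m - n)" by (simp add: of_nat_diff)
  then show ?thesis by simp
qed

lemma N_between_eq_image:
  "N_between (a + 1) (a + real n) = (\<lambda>j. a + real j) ` {1..n}"
proof
  show "N_between (a + 1) (a + real n) \<subseteq> (\<lambda>j. a + real j) ` {1..n}"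
  proof
    fix t assume "t \<in> N_between (a + 1) (a + real n)"
    then obtain k where k: "t = a + 1 + real k" "t \<le> a + real n"
      by (auto simp: N_between_def N_from_iff)
    then have "t = a + real (Suc k)" "Suc k \<in> {1..n}" by auto
    then show "t \<in> (\<lambda>j. a + real j) ` {1..n}" by blast
  qed
  show "(\<lambda>j. a + real j) ` {1..n} \<subseteq> N_between (a + 1) (a + real n)"
  proof
    fix t assume "t \<in> (\<lambda>j. a + real j) ` {1..n}"
    then obtain j where j: "t = a + real j" "1 \<le> j" "j \<le> n" by auto
    then have "t = a + 1 + real (j - 1)" by (simp add: of_nat_diff)
    then show "t \<in> N_between (a + 1) (a + real n)"
      using j N_from_add_nat[of "a + 1" "j - 1"] by (simp add: N_between_def)
  qed
qed

lemma finite_N_between [simp]: "finite (N_between a b)"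
proof -
  have "N_between a b \<subseteq> (\<lambda>n. a + real n) ` {..nat \<lceil>b - a\<rceil>}"
    by (auto simp: N_between_def N_from_iff image_iff) linarith
  then show ?thesis by (rule finite_subset) simp
qed

section \<open>The Caputo difference and the operator\<close>

text \<open>The kernel depends only on the distance \<open>k = t - \<tau>\<close>, so on the grid
  the Caputo difference is a discrete convolution of these weights with the increments.\<close>

definition caputo_weight :: "real \<Rightarrow> nat \<Rightarrow> real" where
  "caputo_weight \<nu> k = rising (real k + 1) (- \<nu>) / Gamma (1 - \<nu>)"

lemma caputo_weight_0:
  assumes "\<nu> < 1"
  shows "caputo_weight \<nu> 0 = 1"
proof -
  have "Gamma (1 - \<nu>) > 0" using assms by (intro Gamma_real_pos) simp
  then show ?thesis by (simp add: caputo_weight_def rising_def)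
qed

lemma caputo_at:
  "caputo \<nu> s x (s + real n) =
     (\<Sum>j\<in>{1..n}. caputo_weight \<nu> (n - j) * nabla x (s + real j))"
  unfolding caputo_def N_between_eq_image
  by (subst sum.reindex) (auto simp: inj_on_def caputo_weight_def of_nat_diff intro!: sum.cong)

text \<open>The newest increment enters with weight
  \<open>Gamma (1 - \<nu>) / Gamma (1 - \<nu>) = 1\<close>. Isolating it makes \<open>L_op\<close>
  an explicit recursion for the next value.\<close>

lemma caputo_at_Suc:
  assumes "\<nu> < 1"
  shows "caputo \<nu> s x (s + real (Suc n)) = nabla x (s + real (Suc n)) +
     (\<Sum>j\<in>{1..n}. caputo_weight \<nu> (Suc n - j) * nabla x (s + real j))"
  unfolding caputo_at using assms by (simp add: caputo_weight_0)

lemma caputo_below: "t < s + 1 \<Longrightarrow> caputo \<nu> s x t = 0"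
proof -
  assume "t < s + 1"
  then have "N_between (s + 1) t = {}" by (force simp: N_between_def dest: N_from_ge)
  then show ?thesis by (simp add: caputo_def)
qed

lemma caputo_cong:
  assumes "\<And>r. r \<in> N_between a t \<Longrightarrow> x r = y r"
  shows "caputo \<nu> a x t = caputo \<nu> a y t"
proof -
  have "nabla x \<tau> = nabla y \<tau>" if "\<tau> \<in> N_between (a + 1) t" for \<tau>
    using that assms[of \<tau>] assms[of "\<tau> - 1"] N_from_cases[of \<tau> a]
    by (auto simp: nabla_def N_between_def N_from_succ_iff)
  then show ?thesis unfolding caputo_def by (intro sum.cong) auto
qed

lemma caputo_diff: "caputo \<nu> a (\<lambda>r. x r - y r) t = caputo \<nu> a x t - caputo \<nu> a y t"
  unfolding caputo_def sum_subtractf[symmetric]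
  by (intro sum.cong) (auto simp: nabla_def algebra_simps add_divide_distrib diff_divide_distrib)

text \<open>The coefficients stand on the right to match the integrand
  \<open>green_fun ... * h s\<close>.\<close>

lemma caputo_sum:
  "caputo \<nu> a (\<lambda>r. \<Sum>i\<in>I. x i r * c i) t = (\<Sum>i\<in>I. caputo \<nu> a (x i) t * c i)"
proof -
  have "nabla (\<lambda>r. \<Sum>i\<in>I. x i r * c i) \<tau> = (\<Sum>i\<in>I. nabla (x i) \<tau> * c i)" for \<tau>
    by (simp add: nabla_def sum_subtractf left_diff_distrib)
  then show ?thesis
    unfolding caputo_def
    by (simp add: sum_distrib_left sum_distrib_right mult.assoc) (rule sum.swap)
qed

lemma L_op_unfold:
  "L_op \<nu> p q a x t =
     p (t + 1) * caputo \<nu> a x (t + 1) - p t * caputo \<nu> a x t + q t * x t"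
  by (simp add: L_op_def nabla_def)

lemma L_op_diff:
  "L_op \<nu> p q a (\<lambda>r. x r - y r) t = L_op \<nu> p q a x t - L_op \<nu> p q a y t"
  by (simp add: L_op_unfold caputo_diff algebra_simps)

lemma L_op_sum:
  "L_op \<nu> p q a (\<lambda>r. \<Sum>i\<in>I. x i r * c i) t = (\<Sum>i\<in>I. L_op \<nu> p q a (x i) t * c i)"
  by (simp add: L_op_unfold caputo_sum sum_distrib_left sum_subtractf sum.distrib
      left_diff_distrib distrib_right mult.assoc)

section \<open>Initial value problems\<close>

text \<open>
  Solving \<open>(L\<^sub>s x)(s + n + 1) = 0\<close> for \<open>x(s + n + 2)\<close>, with \<open>w\<close>, \<open>P\<close>, \<open>Q\<close> the weights and
  coefficients at the grid points.
\<close>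

fun ivp_seq ::
  "(nat \<Rightarrow> real) \<Rightarrow> (nat \<Rightarrow> real) \<Rightarrow> (nat \<Rightarrow> real) \<Rightarrow> real \<Rightarrow> real \<Rightarrow> nat \<Rightarrow> real" where
  "ivp_seq w P Q A B 0 = A"
| "ivp_seq w P Q A B (Suc 0) = A + B"
| "ivp_seq w P Q A B (Suc (Suc n)) =
     ivp_seq w P Q A B (Suc n)
     - (\<Sum>j\<in>{0..n}. w (Suc n - j) * (ivp_seq w P Q A B (Suc j) - ivp_seq w P Q A B j))
     + (P (Suc n) * (\<Sum>j\<in>{0..n}. w (n - j) * (ivp_seq w P Q A B (Suc j) - ivp_seq w P Q A B j))
        - Q (Suc n) * ivp_seq w P Q A B (Suc n)) / P (Suc (Suc n))"

text \<open>Transports the recursive sequence to the grid through its index; positivity of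
  \<open>p\<close> lets the equation be solved for the next value.\<close>

lemma ivp_exists:
  assumes "\<nu> < 1" "\<forall>t\<in>N_from (s + 1). p t > 0"
  obtains x where "\<And>r. r \<notin> N_from s \<Longrightarrow> x r = 0"
    "\<And>r. r \<in> N_from (s + 1) \<Longrightarrow> L_op \<nu> p q s x r = 0"
    "x s = A" "nabla x (s + 1) = B"
proof -
  define f where
    "f = ivp_seq (caputo_weight \<nu>) (\<lambda>n. p (s + real n)) (\<lambda>n. q (s + real n)) A B"
  define x where "x r = (if r \<in> N_from s then f (THE n. r = s + real n) else 0)" for r
  have x_at: "x (s + real n) = f n" for n
    by (simp add: x_def)
  have nabla_at: "nabla x (s + real (Suc n)) = f (Suc n) - f n" for n
    using x_at[of "Suc n"] x_at[of n] by (simp add: nabla_def add.commute add.left_commute)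
  have init: "x s = A"
    using x_at[of 0] by (simp add: f_def)
  have nabla_init: "nabla x (s + 1) = B"
    using nabla_at[of 0] by (simp add: f_def)
  have off: "x r = 0" if "r \<notin> N_from s" for r
    using that by (simp add: x_def)
  have "L_op \<nu> p q s x r = 0" if r: "r \<in> N_from (s + 1)" for r
  proof -
    obtain n where n: "r = s + real (Suc n)"
      using r by (auto simp: N_from_iff algebra_simps)
    have shift: "(\<Sum>j\<in>{1..Suc n}. g j * nabla x (s + real j)) =
        (\<Sum>j\<in>{0..n}. g (Suc j) * (f (Suc j) - f j))" for g :: "nat \<Rightarrow> real"
      unfolding One_nat_def sum.shift_bounds_cl_Suc_ivl nabla_at ..
    have p: "p (s + real (Suc (Suc n))) > 0"
      using bspec[OF assms(2) N_from_add_nat[of "s + 1" "Suc n"]] by (simp add: add.commute add.left_commute)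
    have "caputo \<nu> s x (r + 1) = caputo \<nu> s x (s + real (Suc (Suc n)))"
      by (simp add: n algebra_simps)
    also have "\<dots> = f (Suc (Suc n)) - f (Suc n) +
        (\<Sum>j\<in>{0..n}. caputo_weight \<nu> (Suc n - j) * (f (Suc j) - f j))"
      unfolding caputo_at_Suc[OF assms(1)] shift nabla_at by simp
    \<comment> \<open>The third equation of \<open>ivp_seq\<close> subtracts exactly this history
      sum, so only the quotient survives.\<close>
    also have "\<dots> = (p r * (\<Sum>j\<in>{0..n}. caputo_weight \<nu> (n - j) * (f (Suc j) - f j))
        - q r * x r) / p (s + real (Suc (Suc n)))"
      unfolding n x_at by (simp add: f_def del: of_nat_Suc)
    also have "(\<Sum>j\<in>{0..n}. caputo_weight \<nu> (n - j) * (f (Suc j) - f j)) = caputo \<nu> s x r"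
      unfolding n caputo_at shift by simp
    finally have "caputo \<nu> s x (r + 1) = (p r * caputo \<nu> s x r - q r * x r) / p (r + 1)"
      by (simp add: n algebra_simps)
    moreover have "p (r + 1) > 0" using p by (simp add: n algebra_simps)
    ultimately show ?thesis by (simp add: L_op_unfold)
  qed
  with off show ?thesis using init nabla_init by (rule that)
qed

text \<open>Strong induction: once all earlier increments vanish, the equation reduces to
  \<open>p\<close> times the newest increment being zero, and \<open>p\<close> is positive.\<close>

lemma ivp_trivial:
  assumes "\<nu> < 1" "\<forall>t\<in>N_from (s + 1). p t > 0"
    and L: "\<And>r. r \<in> N_from (s + 1) \<Longrightarrow> L_op \<nu> p q s x r = 0"
    and "x s = 0" "nabla x (s + 1) = 0"
  shows "x (s + real n) = 0"
proof (induction n rule: less_induct)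
  case (less n)
  consider "n = 0" | "n = 1" | m where "n = Suc (Suc m)"
    by (metis One_nat_def not0_implies_Suc)
  then show ?case
  proof cases
    case 1
    then show ?thesis using assms by simp
  next
    case 2
    then show ?thesis using assms by (simp add: nabla_def)
  next
    case 3
    let ?r = "s + real (Suc m)"
    have r: "?r \<in> N_from (s + 1)" "?r + 1 \<in> N_from (s + 1)"
      using N_from_add_nat[of "s + 1" m] N_from_add_nat[of "s + 1" "Suc m"]
      by (simp_all add: add.commute add.left_commute)
    have nabla0: "nabla x (s + real j) = 0" if "j \<in> {1..Suc m}" for j
    proof -
      obtain i where i: "j = Suc i" using \<open>j \<in> {1..Suc m}\<close> by (cases j) auto
      have "x (s + real j) = 0" "x (s + real i) = 0"
        using less[of j] less[of i] that 3 i by (auto simp del: of_nat_Suc)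
      moreover have "s + real j - 1 = s + real i" by (simp add: i)
      ultimately show ?thesis by (simp only: nabla_def diff_self)
    qed
    have "caputo \<nu> s x ?r = 0"
      unfolding caputo_at using nabla0 by (intro sum.neutral) auto
    moreover have "x ?r = 0" using less 3 by blast
    ultimately have "caputo \<nu> s x (?r + 1) = 0"
      using L[OF r(1)] bspec[OF assms(2) r(2)] by (simp add: L_op_unfold)
    moreover have next_eq: "?r + 1 = s + real (Suc (Suc m))" by simp
    have "caputo \<nu> s x (?r + 1) = nabla x (s + real (Suc (Suc m)))"
      unfolding next_eq caputo_at_Suc[OF assms(1)] using nabla0 by (simp add: sum.neutral)
    moreover have "s + real (Suc (Suc m)) - 1 = ?r" by simp
    ultimately show ?thesis using \<open>x ?r = 0\<close> 3 by (simp add: nabla_def del: of_nat_Suc)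
  qed
qed

section \<open>The Cauchy function and its source term\<close>

text \<open>Justifies the definite description: \<open>ivp_exists\<close> yields a candidate, and
  \<open>ivp_trivial\<close> applied to the difference of two candidates makes them agree on the
  grid; off the grid both are 0.\<close>

lemma cauchy_fun:
  assumes "\<nu> < 1" "\<forall>t\<in>N_from (s + 1). p t > 0"
  shows cauchy_fun_off: "r \<notin> N_from s \<Longrightarrow> cauchy_fun \<nu> p q r s = 0"
    and cauchy_fun_L_op:
      "r \<in> N_from (s + 1) \<Longrightarrow> L_op \<nu> p q s (\<lambda>t. cauchy_fun \<nu> p q t s) r = 0"
    and cauchy_fun_self: "cauchy_fun \<nu> p q s s = 0"
    and nabla_cauchy_fun: "nabla (\<lambda>t. cauchy_fun \<nu> p q t s) (s + 1) = 1 / p (s + 1)"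
proof -
  define P where "P x \<longleftrightarrow> (\<forall>r. r \<notin> N_from s \<longrightarrow> x r = 0) \<and>
    (\<forall>r\<in>N_from (s + 1). L_op \<nu> p q s x r = 0) \<and>
    x s = 0 \<and> nabla x (s + 1) = 1 / p (s + 1)" for x
  obtain x where "\<And>r. r \<notin> N_from s \<Longrightarrow> x r = 0"
    "\<And>r. r \<in> N_from (s + 1) \<Longrightarrow> L_op \<nu> p q s x r = 0" "x s = 0"
    "nabla x (s + 1) = 1 / p (s + 1)"
    by (rule ivp_exists[OF assms, where q = q and A = 0 and B = "1 / p (s + 1)"]) (rule that)
  then have "P x" by (simp add: P_def)
  moreover have "y = z" if y: "P y" and z: "P z" for y z
  proof
    fix r
    have "y (s + real n) - z (s + real n) = 0" for n
      by (rule ivp_trivial[OF assms, where q = q and x = "\<lambda>r. y r - z r"])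
        (use y z in \<open>auto simp: P_def L_op_diff nabla_def\<close>)
    then show "y r = z r"
      using y z by (cases "r \<in> N_from s") (auto simp: P_def N_from_iff)
  qed
  ultimately have "P (THE x. P x)" by (metis theI)
  then have "P (\<lambda>t. cauchy_fun \<nu> p q t s)"
    unfolding cauchy_fun_def P_def[symmetric] .
  then show "r \<notin> N_from s \<Longrightarrow> cauchy_fun \<nu> p q r s = 0"
    "r \<in> N_from (s + 1) \<Longrightarrow> L_op \<nu> p q s (\<lambda>t. cauchy_fun \<nu> p q t s) r = 0"
    "cauchy_fun \<nu> p q s s = 0" "nabla (\<lambda>t. cauchy_fun \<nu> p q t s) (s + 1) = 1 / p (s + 1)"
    by (auto simp: P_def)
qed

text \<open>If \<tau> is outside \<open>N_from (s + 1)\<close>, so is \<open>\<tau> - 1\<close>; the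
  increment at \<tau> is then 0, and the two sums differ only by zero terms.\<close>

lemma caputo_change_base:
  assumes "s \<in> N_from a" "\<And>r. r \<notin> N_from (s + 1) \<Longrightarrow> x r = 0"
  shows "caputo \<nu> a x t = caputo \<nu> s x t"
proof -
  have "nabla x \<tau> = 0" if "\<tau> \<notin> N_from (s + 1)" for \<tau>
    using that assms(2)[of \<tau>] assms(2)[of "\<tau> - 1"] N_from_cases[of "\<tau> - 1" s]
    by (auto simp: nabla_def N_from_succ_iff)
  moreover have "s + 1 \<in> N_from (a + 1)" using assms(1) by (simp add: N_from_succ_iff)
  ultimately show ?thesis
    unfolding caputo_def
    by (intro sum.mono_neutral_right finite_N_between)
      (auto simp: N_between_def intro: N_from_trans)
qed

lemma L_op_cauchy_fun:
  assumes "\<nu> < 1" "\<forall>t\<in>N_from (a + 1). p t > 0"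
    and s: "s \<in> N_from (a + 1)" and t: "t \<in> N_from (a + 1)"
  shows "L_op \<nu> p q a (\<lambda>r. cauchy_fun \<nu> p q r s) t = (if t = s then 1 else 0)"
proof -
  let ?x = "\<lambda>r. cauchy_fun \<nu> p q r s"
  have sa: "s \<in> N_from a" and s1: "s + 1 \<in> N_from (a + 1)"
    using s N_from_cases[of s a] by (auto simp: N_from_succ_iff)
  have p: "\<forall>r\<in>N_from (s + 1). p r > 0"
    using assms(2) N_from_trans[OF _ s1] by blast
  note x = cauchy_fun[OF assms(1) p, where q = q]
  have zero: "?x r = 0" if "r \<notin> N_from (s + 1)" for r
    using that x(1)[of r] x(3) N_from_cases[of r s] by auto
  have eq: "L_op \<nu> p q a ?x t = L_op \<nu> p q s ?x t"
    unfolding L_op_unfold using caputo_change_base[OF sa zero] by simp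
  consider "t \<in> N_from (s + 1)" | "t = s" | "t < s"
    using N_from_comparable[OF t s] N_from_cases[of t s] by fastforce
  then show ?thesis
  proof cases
    case 1
    then show ?thesis using x(2) N_from_ge[OF 1] unfolding eq by auto
  next
    \<comment> \<open>At \<open>t = s\<close> the Caputo sum based at \<open>s\<close> is empty and
      \<open>x(s, s) = 0\<close>. Only \<open>p (s + 1)\<close> times the initial increment
      \<open>1 / p (s + 1)\<close> is left.\<close>
    case 2
    have "caputo \<nu> s ?x (s + 1) = 1 / p (s + 1)"
      using caputo_at_Suc[OF assms(1), of s ?x 0] x(4) by simp
    then show ?thesis
      unfolding eq using 2 x(3) bspec[OF p N_from_self] by (simp add: L_op_unfold caputo_below)
  next
    \<comment> \<open>Here \<open>t + 1 < s + 1\<close>, so both Caputo sums based at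
      \<open>s\<close> are empty.\<close>
    case 3
    then have "?x t = 0" using x(1)[of t] N_from_ge[of t s] by auto
    then show ?thesis unfolding eq using 3 by (simp add: L_op_unfold caputo_below)
  qed
qed

section \<open>Boundary value problems\<close>

lemma solves_bvp_cong:
  assumes b: "b \<in> N_from (a + 2)" and xy: "\<And>r. r \<in> N_between a b \<Longrightarrow> x r = y r"
  shows "solves_bvp \<nu> p q a b \<alpha> \<beta> \<gamma> \<delta> h c x \<longleftrightarrow> solves_bvp \<nu> p q a b \<alpha> \<beta> \<gamma> \<delta> h c y"
proof -
  have L: "L_op \<nu> p q a x t = L_op \<nu> p q a y t" if t: "t \<in> N_between (a + 1) (b - 1)" for t
  proof -
    have "t \<in> N_between a b"
      using t N_from_cases[of t a] by (auto simp: N_between_def)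
    \<comment> \<open>The operator at \<open>t\<close> looks one step ahead;
      \<open>t \<le> b - 1\<close> keeps \<open>t + 1\<close> inside the interval.\<close>
    moreover have "caputo \<nu> a x t = caputo \<nu> a y t" "caputo \<nu> a x (t + 1) = caputo \<nu> a y (t + 1)"
      using t by (auto intro!: caputo_cong xy simp: N_between_def)
    ultimately show ?thesis unfolding L_op_unfold using xy by simp
  qed
  obtain n where n: "b = a + 2 + real n" using b by (auto simp: N_from_iff)
  have "{a, a + 1, b, b - 1} \<subseteq> N_between a b"
    using N_from_add_nat[of a 1] N_from_add_nat[of a "n + 2"] N_from_add_nat[of a "n + 1"]
    by (auto simp: N_between_def n algebra_simps)
  then have "x r = y r" if "r \<in> {a, a + 1, b, b - 1}" for r
    using xy that by blast
  then show ?thesis using L by (simp add: solves_bvp_def nabla_def)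
qed

lemma solves_bvp_diff:
  assumes "solves_bvp \<nu> p q a b \<alpha> \<beta> \<gamma> \<delta> h c x" "solves_bvp \<nu> p q a b \<alpha> \<beta> \<gamma> \<delta> h c y"
  shows "solves_bvp \<nu> p q a b \<alpha> \<beta> \<gamma> \<delta> (\<lambda>t. 0) 0 (\<lambda>r. x r - y r)"
  using assms by (auto simp: solves_bvp_def L_op_diff nabla_def algebra_simps)

text \<open>Superposition of sources and right boundary values together. It serves to scale one
  solution, to add \<open>u\<close> and \<open>x\<close>, and to integrate against
  \<open>h\<close>.\<close>

lemma solves_bvp_sum:
  assumes "\<And>i. i \<in> I \<Longrightarrow> solves_bvp \<nu> p q a b \<alpha> \<beta> \<gamma> \<delta> (g i) (d i) (x i)"
  shows "solves_bvp \<nu> p q a b \<alpha> \<beta> \<gamma> \<delta> (\<lambda>t. \<Sum>i\<in>I. g i t * c i) (\<Sum>i\<in>I. d i * c i)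
    (\<lambda>r. \<Sum>i\<in>I. x i r * c i)"
proof -
  have "(\<Sum>i\<in>I. (\<alpha> * x i a - \<beta> * nabla (x i) (a + 1)) * c i) = 0"
    using assms by (intro sum.neutral) (auto simp: solves_bvp_def)
  then have left: "\<alpha> * (\<Sum>i\<in>I. x i a * c i) - \<beta> * nabla (\<lambda>r. \<Sum>i\<in>I. x i r * c i) (a + 1) = 0"
    by (simp add: nabla_def sum_distrib_left sum_subtractf left_diff_distrib right_diff_distrib
        mult.assoc)
  have "(\<Sum>i\<in>I. (\<gamma> * x i b + \<delta> * nabla (x i) b) * c i) = (\<Sum>i\<in>I. d i * c i)"
    using assms by (intro sum.cong) (auto simp: solves_bvp_def)
  then have right: "\<gamma> * (\<Sum>i\<in>I. x i b * c i) + \<delta> * nabla (\<lambda>r. \<Sum>i\<in>I. x i r * c i) b =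
      (\<Sum>i\<in>I. d i * c i)"
    by (simp add: nabla_def sum_distrib_left sum_subtractf sum.distrib left_diff_distrib
        right_diff_distrib distrib_right mult.assoc)
  have "L_op \<nu> p q a (\<lambda>r. \<Sum>i\<in>I. x i r * c i) t = (\<Sum>i\<in>I. g i t * c i)"
    if "t \<in> N_between (a + 1) (b - 1)" for t
    unfolding L_op_sum using assms that by (intro sum.cong) (auto simp: solves_bvp_def)
  with left right show ?thesis by (auto simp: solves_bvp_def)
qed

section \<open>Green's function under unique solvability\<close>

context
  fixes a b \<nu> \<alpha> \<beta> \<gamma> \<delta> :: real
    and p q :: "real \<Rightarrow> real"
  assumes b: "b \<in> N_from (a + 2)"
    and \<nu>: "\<nu> < 1"
    and p: "\<forall>t\<in>N_from (a + 1). p t > 0"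
    and \<alpha>\<beta>: "\<alpha>\<^sup>2 + \<beta>\<^sup>2 > 0"
    and trivial: "\<And>x. solves_bvp \<nu> p q a b \<alpha> \<beta> \<gamma> \<delta> (\<lambda>t. 0) 0 x \<Longrightarrow>
      (\<forall>t\<in>N_between a b. x t = 0)"
begin

lemma homogeneous_bvp_exists:
  obtains x where "solves_bvp \<nu> p q a b \<alpha> \<beta> \<gamma> \<delta> (\<lambda>t. 0) c x"
proof -
  obtain x where L: "\<And>r. r \<in> N_from (a + 1) \<Longrightarrow> L_op \<nu> p q a x r = 0"
    and xa: "x a = \<beta>" "nabla x (a + 1) = \<alpha>"
    using ivp_exists[OF \<nu> p, where q = q and A = \<beta> and B = \<alpha>] by blast
  define B where "B = \<gamma> * x b + \<delta> * nabla x b"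
  have sol: "solves_bvp \<nu> p q a b \<alpha> \<beta> \<gamma> \<delta> (\<lambda>t. 0) B x"
    using L xa by (auto simp: solves_bvp_def B_def N_between_def)
  \<comment> \<open>Otherwise \<open>x\<close> would be a trivial solution, and its initial data
    \<beta> and \<alpha> would both be 0.\<close>
  have "B \<noteq> 0"
  proof
    assume "B = 0"
    then have "\<forall>t\<in>N_between a b. x t = 0" using sol trivial by simp
    moreover have "a \<in> N_between a b" "a + 1 \<in> N_between a b"
      using N_from_add_nat[of a 1] N_from_ge[OF b] by (auto simp: N_between_def)
    ultimately show False using xa \<alpha>\<beta> by (simp add: nabla_def)
  qed
  \<comment> \<open>Scaling by \<open>c / B\<close>, as a superposition over a one-element index
    set.\<close>
  then have "solves_bvp \<nu> p q a b \<alpha> \<beta> \<gamma> \<delta> (\<lambda>t. 0) c (\<lambda>r. x r * (c / B))"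
    using solves_bvp_sum[of "{()}" \<nu> p q a b \<alpha> \<beta> \<gamma> \<delta> "\<lambda>_ _. 0" "\<lambda>_. B" "\<lambda>_. x" "\<lambda>_. c / B"] sol
    by simp
  then show ?thesis by (rule that)
qed

lemma solves_bvp_unique:
  assumes "solves_bvp \<nu> p q a b \<alpha> \<beta> \<gamma> \<delta> h c x" "solves_bvp \<nu> p q a b \<alpha> \<beta> \<gamma> \<delta> h c y"
    and "t \<in> N_between a b"
  shows "x t = y t"
  using trivial[OF solves_bvp_diff[OF assms(1,2)]] assms(3) by simp

lemma green_u_solves:
  "solves_bvp \<nu> p q a b \<alpha> \<beta> \<gamma> \<delta> (\<lambda>r. 0)
     (- (\<gamma> * cauchy_fun \<nu> p q b s + \<delta> * nabla (\<lambda>r. cauchy_fun \<nu> p q r s) b))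
     (\<lambda>t. green_u \<nu> p q a b \<alpha> \<beta> \<gamma> \<delta> t s)"
proof -
  define c where "c = - (\<gamma> * cauchy_fun \<nu> p q b s + \<delta> * nabla (\<lambda>r. cauchy_fun \<nu> p q r s) b)"
  define P where "P u \<longleftrightarrow> (\<forall>r. r \<notin> N_between a b \<longrightarrow> u r = 0) \<and>
    solves_bvp \<nu> p q a b \<alpha> \<beta> \<gamma> \<delta> (\<lambda>r. 0) c u" for u
  obtain x where x: "solves_bvp \<nu> p q a b \<alpha> \<beta> \<gamma> \<delta> (\<lambda>t. 0) c x"
    using homogeneous_bvp_exists .
  \<comment> \<open>Cutting off outside the interval meets the off-domain clause of the description
    and leaves the boundary value problem unchanged.\<close>
  then have "solves_bvp \<nu> p q a b \<alpha> \<beta> \<gamma> \<delta> (\<lambda>t. 0) c (\<lambda>r. if r \<in> N_between a b then x r else 0)"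
    by (subst solves_bvp_cong[OF b, of _ x]) auto
  then have "P (\<lambda>r. if r \<in> N_between a b then x r else 0)"
    by (simp add: P_def)
  moreover have "u = v" if "P u" "P v" for u v
    using that solves_bvp_unique unfolding P_def by (metis ext)
  ultimately have "P (THE u. P u)" by (metis theI)
  then have "P (\<lambda>t. green_u \<nu> p q a b \<alpha> \<beta> \<gamma> \<delta> t s)"
    unfolding green_u_def P_def[symmetric] c_def[symmetric] .
  then show ?thesis by (simp add: P_def c_def)
qed

text \<open>For \<open>t \<le> s\<close> the Cauchy function is 0, by its initial value or by being
  off its grid, so the two branches merge into one formula.\<close>

lemma green_fun_eq:
  assumes "s \<in> N_from a"
  shows "green_fun \<nu> p q a b \<alpha> \<beta> \<gamma> \<delta> t s =
    green_u \<nu> p q a b \<alpha> \<beta> \<gamma> \<delta> t s + cauchy_fun \<nu> p q t s"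
proof -
  have "\<forall>r\<in>N_from (s + 1). p r > 0"
    using p N_from_trans[of _ "s + 1" "a + 1"] assms by (simp add: N_from_succ_iff)
  note x = cauchy_fun(1,3)[OF \<nu> this, where q = q]
  have "cauchy_fun \<nu> p q t s = 0" if "t \<le> s"
    using that x(1)[of t] x(2) N_from_ge[of t s] by (cases "t = s") auto
  then show ?thesis by (simp add: green_fun_def green_v_def)
qed

text \<open>The Cauchy function supplies the unit source at \<open>s\<close>, and the right boundary
  value prescribed for \<open>u\<close> cancels the one it produces at \<open>b\<close>.\<close>

lemma green_fun_solves:
  assumes s: "s \<in> N_from (a + 1)"
  shows "solves_bvp \<nu> p q a b \<alpha> \<beta> \<gamma> \<delta> (\<lambda>t. if t = s then 1 else 0) 0
    (\<lambda>t. green_fun \<nu> p q a b \<alpha> \<beta> \<gamma> \<delta> t s)"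
proof -
  let ?x = "\<lambda>t. cauchy_fun \<nu> p q t s" and ?u = "\<lambda>t. green_u \<nu> p q a b \<alpha> \<beta> \<gamma> \<delta> t s"
  have sa: "s \<in> N_from a" using s N_from_cases by blast
  have "\<forall>r\<in>N_from (s + 1). p r > 0"
    using p N_from_trans[of _ "s + 1" "a + 1"] sa by (simp add: N_from_succ_iff)
  note x = cauchy_fun(1,3)[OF \<nu> this, where q = q]
  \<comment> \<open>Since \<open>s \<ge> a + 1\<close>, both points are at or below
    \<open>s\<close>; this gives the left boundary condition.\<close>
  have "?x a = 0" "?x (a + 1) = 0"
    using N_from_ge[OF s] x(1)[of a] x(1)[of "a + 1"] x(2) N_from_ge[of a s]
      N_from_ge[of "a + 1" s] by (force, cases "s = a + 1", auto)
  then have x_bvp: "solves_bvp \<nu> p q a b \<alpha> \<beta> \<gamma> \<delta> (\<lambda>t. if t = s then 1 else 0)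
      (\<gamma> * ?x b + \<delta> * nabla ?x b) ?x"
    using L_op_cauchy_fun[OF \<nu> p s, of _ q]
    by (auto simp: solves_bvp_def nabla_def N_between_def)
  show ?thesis
    \<comment> \<open>The index set is the two truth values: \<open>True\<close> stands for the
      Cauchy function, \<open>False\<close> for \<open>u\<close>.\<close>
    using solves_bvp_sum[of UNIV \<nu> p q a b \<alpha> \<beta> \<gamma> \<delta>
        "\<lambda>i t. if i \<and> t = s then 1 else 0"
        "\<lambda>i. if i then \<gamma> * ?x b + \<delta> * nabla ?x b else - (\<gamma> * ?x b + \<delta> * nabla ?x b)"
        "\<lambda>i. if i then ?x else ?u" "\<lambda>_. 1"] x_bvp green_u_solves[of s]
    by (simp add: UNIV_bool green_fun_eq[OF sa] cong: if_cong)
qed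

lemma green_integral_solves:
  "solves_bvp \<nu> p q a b \<alpha> \<beta> \<gamma> \<delta> h 0
     (\<lambda>t. nabla_integral a b (\<lambda>s. green_fun \<nu> p q a b \<alpha> \<beta> \<gamma> \<delta> t s * h s))"
proof -
  let ?I = "N_between (a + 1) b"
  have ab: "a < b" using N_from_ge[OF b] by simp
  \<comment> \<open>The equation is imposed only up to \<open>b - 1\<close>, so the source belonging
    to \<open>s = b\<close> never fires and the arbitrary value \<open>h b\<close> does not
    enter.\<close>
  have delta: "(\<Sum>s\<in>?I. (if t = s then 1 else 0) * h s) = h t"
    if "t \<in> N_between (a + 1) (b - 1)" for t
  proof -
    have "t \<in> ?I" using that by (auto simp: N_between_def)
    then show ?thesis by (simp add: if_distrib[of "\<lambda>z. z * _"] cong: if_cong)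
  qed
  have "solves_bvp \<nu> p q a b \<alpha> \<beta> \<gamma> \<delta> (\<lambda>t. \<Sum>s\<in>?I. (if t = s then 1 else 0) * h s)
      (\<Sum>s\<in>?I. 0 * h s) (\<lambda>t. \<Sum>s\<in>?I. green_fun \<nu> p q a b \<alpha> \<beta> \<gamma> \<delta> t s * h s)"
    by (rule solves_bvp_sum) (auto simp: N_between_def intro: green_fun_solves)
  then show ?thesis
    using delta ab by (simp add: solves_bvp_def nabla_integral_def)
qed

end

theorem theorem29:
  fixes a b \<nu> \<alpha> \<beta> \<gamma> \<delta> :: real
    and p q h :: "real \<Rightarrow> real"
  assumes "b \<in> N_from (a + 2)"
    and "0 < \<nu>" and "\<nu> < 1"
    and "\<And>t. t \<in> N_from (a + 1) \<Longrightarrow> p t > 0"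
    and "\<alpha>\<^sup>2 + \<beta>\<^sup>2 > 0" and "\<gamma>\<^sup>2 + \<delta>\<^sup>2 > 0"
    and "\<And>x. solves_bvp \<nu> p q a b \<alpha> \<beta> \<gamma> \<delta> (\<lambda>t. 0) 0 x \<Longrightarrow> (\<forall>t\<in>N_between a b. x t = 0)"
  shows "\<forall>y. solves_bvp \<nu> p q a b \<alpha> \<beta> \<gamma> \<delta> h 0 y \<longleftrightarrow>
    (\<forall>t\<in>N_between a b.
       y t = nabla_integral a b (\<lambda>s. green_fun \<nu> p q a b \<alpha> \<beta> \<gamma> \<delta> t s * h s))"
proof (intro allI iffI ballI)
  have p: "\<forall>t\<in>N_from (a + 1). p t > 0" using assms(4) by blast
  note hyps = assms(1,3) p assms(5,7)
  fix y t
  assume "solves_bvp \<nu> p q a b \<alpha> \<beta> \<gamma> \<delta> h 0 y" "t \<in> N_between a b"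
  then show "y t = nabla_integral a b (\<lambda>s. green_fun \<nu> p q a b \<alpha> \<beta> \<gamma> \<delta> t s * h s)"
    using solves_bvp_unique[OF hyps _ green_integral_solves[OF hyps]] by blast
next
  have p: "\<forall>t\<in>N_from (a + 1). p t > 0" using assms(4) by blast
  note hyps = assms(1,3) p assms(5,7)
  fix y
  assume "\<forall>t\<in>N_between a b.
    y t = nabla_integral a b (\<lambda>s. green_fun \<nu> p q a b \<alpha> \<beta> \<gamma> \<delta> t s * h s)"
  then show "solves_bvp \<nu> p q a b \<alpha> \<beta> \<gamma> \<delta> h 0 y"
    \<comment> \<open>The function \<open>y\<close> matches the integral only on the interval, which
      is all that the boundary value problem sees.\<close>
    using green_integral_solves[OF hyps] by (subst solves_bvp_cong[OF assms(1)]) auto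
qed

end
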